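(* Let $n\ge3$ and let $\Lambda\ne0$ be an admissible weight with $\kappa=p/p'$ ($p,p'$ coprime positive integers, $p\ge n$). Let $\vec a=(a_0,\dots,a_{n-1})$, $\vec b=(b_0,\dots,b_{n-1})$ be the pair of sequences of nonnegative integers with $\Lambda=\Lambda(\vec a,\vec b)$, and let $g_s=g_s(\vec b)$, $s\in\mathbb Z$. Let $\underline d$ be an affine Gelfand--Tsetlin pattern. Then $\underline d$ is permitted with respect to $\Lambda$ if and only if $$d_{i,g_s}\le d_{i+1,g_{s+1}}+a_s\qquad\text{for all } s\in\{0,\dots,n-1\}\text{ and all } i\ge g_{s+1}-1.$$
   Context: **Root data.** $\mathfrak h^*=\{\sum_{i=1}^nc_i\epsilon_i:\sum c_i=0\}$ with $(\epsilon_i,\epsilon_j)=\delta_{ij}$; $\widetilde{\mathfrak h}^*=\mathfrak h^*\oplus\mathbb C\delta\oplus\mathbb C\omega_0$ with $(\delta,\omega_0)=1$, $(\delta,\delta)=(\omega_0,\omega_0)=0$, $\delta,\omega_0\perp\mathfrak h^*$. $\alpha_i=\epsilon_i-\epsilon_{i+1}$ ($1\le i\le n-1$), $\alpha_0=\delta+\epsilon_n-\epsilon_1$, $\alpha_{i+n}=\alpha_i$. $\omega_0,\dots,\omega_{n-1}$: $(\omega_i,\alpha_j)=\delta_{ij}$ ($0\le j\le n-1$), $(\omega_i,\omega_0)=0$; $\rho=\sum_{i=0}^{n-1}\omega_i$. With $\Phi=\{\epsilon_i-\epsilon_j:i\ne j\}$: $\widehat\Phi=\{\alpha+m\delta:\alpha\in\Phi,m\in\mathbb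 Z\}\cup\{m\delta:m\ne0\}$; $\widehat\Phi_+$ consists of $\alpha+m\delta$ ($\alpha\in\Phi$, $m>0$), $\epsilon_i-\epsilon_j$ ($i<j$), $m\delta$ ($m>0$). For integers $l<r$, $\alpha_{l,r}=\sum_{s=l}^{r-1}\alpha_s$. $W\cong\mathfrak S_n$ is the finite Weyl group, $P=\operatorname{Span}_{\mathbb Z}\{\omega_i-\omega_0\}_{i=1}^{n-1}$ acts by $t_V(v)=v-(v,V)\delta$ for $v\in\mathfrak h^*\oplus\mathbb C\delta$, $t_V(\omega_0)=\omega_0+V-\frac{(V,V)}2\delta$; $\widehat W^e=W\ltimes P$. **Weights.** $\Lambda\in\omega_0^\perp=\operatorname{Span}_{\mathbb C}(\omega_0,\dots,\omega_{n-1})$; $k=(\Lambda,\delta)$, $\kappa=k+n$. $\Lambda$ is dominant if $(\Lambda+\rho,\alpha)\notin\mathbb Z_{\le0}$ for all $\alpha\in\widehat\Phi_+$; a dominant $\Lambda$ is admissible if the $\mathbb Z$-span of $\{\beta\in\widehat\Phi:(\beta,\Lambda+\rho)\in\mathbb Z\}$ is a full-rank sublattice of $\operatorname{Span}_{\mathbb Z}\{\alpha_0,\dots,\alpha_{n-1}\}$. Then $\kappa=p/p'$ with $p,p'$ coprime positive integers and $p\ge n$. **Parametrization.** For $\vec b=(b_0,\dots,b_{n-1})\in\mathbb Z_{\ge0}^n$, $(g_s(\vec b))_{s\in\mathbb Z}$ is the sequence with $g_0=0$ and $g_{s+1}-g_s=b_{s\bmod n}+1$. Let $\alpha_i'=\alpha_i$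 for $1\le i\le n-1$ and $\alpha_0'=\alpha_0+(p'-1)\delta$. If $\sum b_i=p'n-n$ and $g_0,\dots,g_{n-1}$ are pairwise distinct modulo $n$, let $\gamma_{\vec g(\vec b)}\in\widehat W^e$ be the unique element with $\gamma_{\vec g(\vec b)}(\alpha_i')=\alpha_{g_i,g_{i+1}}$ for $0\le i\le n-1$. For such $\vec b$ and $\vec a\in\mathbb Z_{\ge0}^n$ with $\sum a_i=p-n$ put $$\Lambda(\vec a,\vec b)=\gamma_{\vec g(\vec b)}\Big(\sum_{i=0}^{n-1}a_i\omega_i-(p'-1)\kappa\,\omega_0+\rho\Big)-\rho-c\,\delta,$$ with $c\in\mathbb Q$ fixed by $\Lambda(\vec a,\vec b)\in\omega_0^\perp$. Every admissible weight with $\kappa=p/p'$ is $\Lambda(\vec a,\vec b)$ for a unique such pair. **Patterns.** An affine Gelfand--Tsetlin pattern is an array $\underline d=(d_{i,j})_{i\ge j,\ i,j\in\mathbb Z}$ of nonnegative integers with $d_{i,j}\ge d_{i+1,j}$, $d_{i+n,j+n}=d_{i,j}$, and for each $i$ only finitely many $d_{i,j}\ne0$. With $\mathtt y_l-\mathtt y_r=(\alpha_{l,r},\Lambda+\rho)$ for $l<r$, $\underline d$ is permitted with respect to $\Lambda$ if for all integers $l<r$ with $l\not\equiv r\pmod n$ and $\mathtt y_l-\mathtt y_r\in\mathbb Z$, and all $i\ge r-1$: $d_{i,l}\le d_{i+1,r}+\mathtt y_l-\mathtt y_r-1$. *)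

theory Defs
  imports
    Complex_Main
    "HOL-Library.Function_Algebras"
    "HOL-Library.Product_Plus"
    "HOL-Library.Nonpos_Ints"
    "HOL-Combinatorics.Permutations"
begin

section \<open>The space of weights and its bilinear form\<close>

text \<open>
  The triple \<open>(c, x, y)\<close> stands for \<open>(\<Sum>i=1..n. c i \<epsilon>\<^sub>i) + x \<delta> + y \<omega>\<^sub>0\<close>. The rank parameter
  \<open>n\<close> is an ordinary argument, so membership in the space for a given \<open>n\<close> is the set
  \<open>h_tilde n\<close>; addition and subtraction are the componentwise library operations.
\<close>

type_synonym weight = "(int \<Rightarrow> complex) \<times> complex \<times> complex"

definition scale :: "complex \<Rightarrow> weight \<Rightarrow> weight" (infixr \<open>*\<^sub>W\<close> 75) where
  "t *\<^sub>W v = ((\<lambda>i. t * fst v i), t * fst (snd v), t * snd (snd v))"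

definition eps :: "int \<Rightarrow> weight" where
  "eps i = ((\<lambda>j. if j = i then 1 else 0), 0, 0)"

definition delta :: weight where
  "delta = (0, 1, 0)"

definition omega_zero :: weight where
  "omega_zero = (0, 0, 1)"

definition form :: "nat \<Rightarrow> weight \<Rightarrow> weight \<Rightarrow> complex" where
  "form n v w = (\<Sum>i = 1..int n. fst v i * fst w i)
      + fst (snd v) * snd (snd w) + snd (snd v) * fst (snd w)"

definition h_tilde :: "nat \<Rightarrow> weight set" where
  "h_tilde n = {v. (\<forall>i. i \<notin> {1..int n} \<longrightarrow> fst v i = 0) \<and> (\<Sum>i = 1..int n. fst v i) = 0}"

definition omega_zero_perp :: "nat \<Rightarrow> weight set" where
  "omega_zero_perp n = {v \<in> h_tilde n. form n v omega_zero = 0}"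

abbreviation zscale :: "int \<Rightarrow> weight \<Rightarrow> weight" where
  "zscale m v \<equiv> of_int m *\<^sub>W v"

lemma module_zscale: "module zscale"
  by unfold_locales (auto simp: scale_def prod_eq_iff algebra_simps)

abbreviation zspan :: "weight set \<Rightarrow> weight set" where
  "zspan \<equiv> module.span zscale"


section \<open>Roots, fundamental weights and lattices\<close>

definition alpha :: "nat \<Rightarrow> int \<Rightarrow> weight" where
  "alpha n i = (let j = i mod int n in
     if j = 0 then delta + eps (int n) - eps 1 else eps j - eps (j + 1))"

definition alpha_seg :: "nat \<Rightarrow> int \<Rightarrow> int \<Rightarrow> weight" where
  "alpha_seg n l r = (\<Sum>s = l..<r. alpha n s)"

definition omega :: "nat \<Rightarrow> nat \<Rightarrow> weight" where
  "omega n i = (THE w. w \<in> h_tilde n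
     \<and> (\<forall>j<n. form n w (alpha n (int j)) = (if i = j then 1 else 0))
     \<and> form n w omega_zero = 0)"

definition rho :: "nat \<Rightarrow> weight" where
  "rho n = (\<Sum>i<n. omega n i)"

definition fin_roots :: "nat \<Rightarrow> weight set" where
  "fin_roots n = {eps i - eps j | i j. i \<in> {1..int n} \<and> j \<in> {1..int n} \<and> i \<noteq> j}"

definition aff_roots :: "nat \<Rightarrow> weight set" where
  "aff_roots n = {\<alpha> + zscale m delta | \<alpha> m. \<alpha> \<in> fin_roots n} \<union> {zscale m delta | m. m \<noteq> 0}"

definition pos_aff_roots :: "nat \<Rightarrow> weight set" where
  "pos_aff_roots n =
     {\<alpha> + zscale m delta | \<alpha> m. \<alpha> \<in> fin_roots n \<and> m > 0}
     \<union> {eps i - eps j | i j. i \<in> {1..int n} \<and> j \<in> {1..int n} \<and> i < j}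
     \<union> {zscale m delta | m. m > 0}"

definition root_lattice :: "nat \<Rightarrow> weight set" where
  "root_lattice n = zspan {alpha n (int i) | i. i < n}"

text \<open>
  The rank is the largest size of a \<open>\<int>\<close>-linearly independent subset. It is only used for
  subgroups of finitely generated lattices, where these sizes are bounded.
\<close>

definition lattice_rank :: "weight set \<Rightarrow> nat" where
  "lattice_rank L = Sup {card B | B. finite B \<and> B \<subseteq> L \<and> \<not> module.dependent zscale B}"

definition full_rank_sublattice :: "weight set \<Rightarrow> weight set \<Rightarrow> bool" where
  "full_rank_sublattice L M \<longleftrightarrow>
     module.subspace zscale L \<and> L \<subseteq> M \<and> lattice_rank L = lattice_rank M"


section \<open>Admissible weights\<close>

definition kappa :: "nat \<Rightarrow> weight \<Rightarrow> complex" where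
  "kappa n \<Lambda> = form n \<Lambda> delta + of_nat n"

definition dominant :: "nat \<Rightarrow> weight \<Rightarrow> bool" where
  "dominant n \<Lambda> \<longleftrightarrow> \<Lambda> \<in> omega_zero_perp n
     \<and> (\<forall>\<alpha> \<in> pos_aff_roots n. form n (\<Lambda> + rho n) \<alpha> \<notin> \<int>\<^sub>\<le>\<^sub>0)"

definition admissible :: "nat \<Rightarrow> weight \<Rightarrow> bool" where
  "admissible n \<Lambda> \<longleftrightarrow> dominant n \<Lambda>
     \<and> full_rank_sublattice (zspan {\<beta> \<in> aff_roots n. form n \<beta> (\<Lambda> + rho n) \<in> \<int>})
         (root_lattice n)"


section \<open>The extended affine Weyl group\<close>

text \<open>
  \<open>perm_act \<sigma>\<close> sends \<open>\<epsilon>\<^sub>i\<close> to \<open>\<epsilon>\<^bsub>\<sigma> i\<^esub>\<close> and fixes \<open>\<delta>\<close> and \<open>\<omega>\<^sub>0\<close>; \<open>transl n V\<close> is the linear map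
  determined by \<open>v \<mapsto> v - (v,V) \<delta>\<close> on \<open>h\<^sup>* \<oplus> \<complex>\<delta>\<close> and \<open>\<omega>\<^sub>0 \<mapsto> \<omega>\<^sub>0 + V - (V,V)/2 \<delta>\<close>, that is, with
  \<open>y\<close> the \<open>\<omega>\<^sub>0\<close>-coordinate of \<open>v\<close> (and \<open>V\<close> orthogonal to \<open>\<omega>\<^sub>0\<close>), \<open>v \<mapsto> v + y V - ((v,V) + y (V,V)/2) \<delta>\<close>.
  The group is realised as a set of transformations; its action is faithful.
\<close>

definition perm_act :: "(int \<Rightarrow> int) \<Rightarrow> weight \<Rightarrow> weight" where
  "perm_act \<sigma> v = (fst v \<circ> inv \<sigma>, snd v)"

definition P_lattice :: "nat \<Rightarrow> weight set" where
  "P_lattice n = zspan {omega n i - omega n 0 | i. i \<in> {1..n - 1}}"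

definition transl :: "nat \<Rightarrow> weight \<Rightarrow> weight \<Rightarrow> weight" where
  "transl n V v = v + snd (snd v) *\<^sub>W V
      - (form n v V + snd (snd v) * form n V V / 2) *\<^sub>W delta"

definition ext_aff_weyl :: "nat \<Rightarrow> (weight \<Rightarrow> weight) set" where
  "ext_aff_weyl n =
     {perm_act \<sigma> \<circ> transl n V | \<sigma> V. \<sigma> permutes {1..int n} \<and> V \<in> P_lattice n}"

lemma transl_on_h_delta:
  "snd (snd v) = 0 \<Longrightarrow> transl n V v = v - form n v V *\<^sub>W delta"
  by (simp add: transl_def scale_def prod_eq_iff fun_eq_iff)

lemma transl_omega_zero:
  "fst (snd V) = 0 \<Longrightarrow> transl n V omega_zero = omega_zero + V - (form n V V / 2) *\<^sub>W delta"
  by (simp add: transl_def scale_def omega_zero_def form_def prod_eq_iff fun_eq_iff)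

lemma perm_act_eps: "\<sigma> permutes S \<Longrightarrow> perm_act \<sigma> (eps i) = eps (\<sigma> i)"
  by (auto simp: perm_act_def eps_def fun_eq_iff permutes_inv_eq)


section \<open>The parametrization of admissible weights\<close>

text \<open>Tuples indexed by \<open>0, \<dots>, n-1\<close> are functions on \<open>nat\<close> of which only the values below \<open>n\<close> matter.\<close>

definition gseq :: "nat \<Rightarrow> (nat \<Rightarrow> nat) \<Rightarrow> int \<Rightarrow> int" where
  "gseq n b s = (\<Sum>t = 0..<s. int (b (nat (t mod int n))) + 1)
              - (\<Sum>t = s..<0. int (b (nat (t mod int n))) + 1)"

lemma gseq_0: "gseq n b 0 = 0"
  by (simp add: gseq_def)

lemma gseq_step: "gseq n b (s + 1) - gseq n b s = int (b (nat (s mod int n))) + 1"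
proof (cases "s \<ge> 0")
  case True
  then have "{0..<s + 1} = insert s {0..<s}" by auto
  with True show ?thesis by (simp add: gseq_def)
next
  case False
  then have "{s..<0} = insert s {s + 1..<0}" by auto
  with False show ?thesis by (simp add: gseq_def)
qed

definition alpha_prime :: "nat \<Rightarrow> nat \<Rightarrow> nat \<Rightarrow> weight" where
  "alpha_prime n p' i =
     (if i = 0 then alpha n 0 + (of_nat p' - 1) *\<^sub>W delta else alpha n (int i))"

definition gamma_g :: "nat \<Rightarrow> nat \<Rightarrow> (nat \<Rightarrow> nat) \<Rightarrow> weight \<Rightarrow> weight" where
  "gamma_g n p' b = (THE \<gamma>. \<gamma> \<in> ext_aff_weyl n
     \<and> (\<forall>i<n. \<gamma> (alpha_prime n p' i) = alpha_seg n (gseq n b (int i)) (gseq n b (int i + 1))))"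

definition param_pair :: "nat \<Rightarrow> nat \<Rightarrow> nat \<Rightarrow> (nat \<Rightarrow> nat) \<Rightarrow> (nat \<Rightarrow> nat) \<Rightarrow> bool" where
  "param_pair n p p' a b \<longleftrightarrow>
     (\<Sum>i<n. a i) = p - n \<and> (\<Sum>i<n. b i) = p' * n - n
     \<and> inj_on (\<lambda>s. gseq n b (int s) mod int n) {..<n}"

definition Lambda_ab :: "nat \<Rightarrow> nat \<Rightarrow> nat \<Rightarrow> (nat \<Rightarrow> nat) \<Rightarrow> (nat \<Rightarrow> nat) \<Rightarrow> weight" where
  "Lambda_ab n p p' a b =
     (let v = gamma_g n p' b ((\<Sum>i<n. of_nat (a i) *\<^sub>W omega n i)
                - ((of_nat p' - 1) * (of_nat p / of_nat p')) *\<^sub>W omega_zero + rho n) - rho n;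
          c = (THE c. c \<in> \<rat> \<and> v - c *\<^sub>W delta \<in> omega_zero_perp n)
      in v - c *\<^sub>W delta)"


section \<open>Affine Gelfand--Tsetlin patterns\<close>

text \<open>An array is a function \<open>d\<close> on all index pairs of which only the values \<open>d i j\<close> with \<open>i \<ge> j\<close> matter.\<close>

definition affine_GT_pattern :: "nat \<Rightarrow> (int \<Rightarrow> int \<Rightarrow> nat) \<Rightarrow> bool" where
  "affine_GT_pattern n d \<longleftrightarrow>
     (\<forall>i j. i \<ge> j \<longrightarrow> d i j \<ge> d (i + 1) j)
     \<and> (\<forall>i j. i \<ge> j \<longrightarrow> d (i + int n) (j + int n) = d i j)
     \<and> (\<forall>i. finite {j. j \<le> i \<and> d i j \<noteq> 0})"

text \<open>\<open>y_diff n \<Lambda> l r\<close> is the difference \<open>y\<^sub>l - y\<^sub>r\<close>, for \<open>l < r\<close>.\<close>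

definition y_diff :: "nat \<Rightarrow> weight \<Rightarrow> int \<Rightarrow> int \<Rightarrow> complex" where
  "y_diff n \<Lambda> l r = form n (alpha_seg n l r) (\<Lambda> + rho n)"

definition permitted :: "nat \<Rightarrow> weight \<Rightarrow> (int \<Rightarrow> int \<Rightarrow> nat) \<Rightarrow> bool" where
  "permitted n \<Lambda> d \<longleftrightarrow>
     (\<forall>l r m. l < r \<longrightarrow> l mod int n \<noteq> r mod int n \<longrightarrow> y_diff n \<Lambda> l r = of_int m
        \<longrightarrow> (\<forall>i \<ge> r - 1. int (d i l) \<le> int (d (i + 1) r) + m - 1))"

end

theory Submission
  imports Defs
begin

text \<open>
  With \<open>\<epsilon>\<^sub>l\<close> extended to all integers \<open>l\<close> by \<open>\<epsilon>\<^bsub>l+n\<^esub> = \<epsilon>\<^sub>l - \<delta>\<close>, every affine root segment is a difference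
  \<open>\<alpha>\<^bsub>l,r\<^esub> = \<epsilon>\<^sub>l - \<epsilon>\<^sub>r\<close>. Hence \<open>y\<^sub>l = (\<epsilon>\<^sub>l, \<Lambda> + \<rho>)\<close> is an honest function of \<open>l\<close> whose differences are the
  numbers in the definition of a permitted pattern, and \<open>y\<^bsub>l+n\<^esub> = y\<^sub>l - \<kappa>\<close>.

  The element \<open>\<gamma>\<close> of the extended affine Weyl group is an isometry that fixes \<open>\<delta>\<close> and carries
  \<open>\<alpha>'\<^sub>s\<close> to the segment from \<open>g\<^sub>s\<close> to \<open>g\<^bsub>s+1\<^esub>\<close>, so \<open>y\<close> drops by
  \<open>(\<alpha>'\<^sub>s, \<Sum>a\<^sub>i\<omega>\<^sub>i - (p'-1)\<kappa>\<omega>\<^sub>0 + \<rho>) = a\<^sub>s + 1\<close> between consecutive terms of the sequence \<open>g\<close>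
  (\<open>y_diff_gseq\<close>). Since \<open>\<gamma>\<close> is given by a definite description, this requires that such an
  element exists and is unique (\<open>ext_aff_weyl_exists\<close>, \<open>ext_aff_weyl_eqI\<close>): the finite parts of the
  images determine the permutation, and the coefficients of \<open>\<delta>\<close> determine the translation.

  The terms of \<open>g\<close> represent all residues modulo \<open>n\<close>, and \<open>g\<^bsub>s+n\<^esub> = g\<^sub>s + p'n\<close>. As \<open>\<kappa> = p/p'\<close> is in lowest
  terms, \<open>y\<^sub>l - y\<^sub>r\<close> is an integer exactly when \<open>l\<close> and \<open>r\<close> are two terms of the sequence \<open>g\<close> after one common shift
  by a multiple of \<open>n\<close> (\<open>integral_pair_gseq\<close>). Patterns are invariant under such shifts, so only
  the conditions for pairs \<open>g\<^sub>s, g\<^sub>t\<close> with \<open>s < t\<close> matter. Those for \<open>t = s + 1\<close> are the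
  inequalities of the theorem. They imply the others, because a chain of adjacent inequalities,
  joined by the monotonicity of \<open>d\<close> in its first index, has total slack \<open>\<Sum>a\<^sub>q\<close>
  (\<open>pattern_chain\<close>), which is at most \<open>y\<^bsub>g s\<^esub> - y\<^bsub>g t\<^esub> - 1 = \<Sum>(a\<^sub>q + 1) - 1\<close>.
\<close>

section \<open>The bilinear form in coordinates\<close>

lemma scale_sel [simp]:
  "fst (t *\<^sub>W v) i = t * fst v i"
  "fst (snd (t *\<^sub>W v)) = t * fst (snd v)"
  "snd (snd (t *\<^sub>W v)) = t * snd (snd v)"
  by (simp_all add: scale_def)

lemma delta_sel [simp]: "fst delta i = 0" "fst (snd delta) = 1" "snd (snd delta) = 0"
  by (simp_all add: delta_def)

lemma omega_zero_sel [simp]: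
  "fst omega_zero i = 0" "fst (snd omega_zero) = 0" "snd (snd omega_zero) = 1"
  by (simp_all add: omega_zero_def)

lemma eps_sel [simp]:
  "fst (eps i) j = (if j = i then 1 else 0)" "fst (snd (eps i)) = 0" "snd (snd (eps i)) = 0"
  by (simp_all add: eps_def)

lemma perm_act_sel [simp]:
  "fst (perm_act \<sigma> v) i = fst v (inv \<sigma> i)"
  "fst (snd (perm_act \<sigma> v)) = fst (snd v)"
  "snd (snd (perm_act \<sigma> v)) = snd (snd v)"
  by (simp_all add: perm_act_def)

lemma transl_sel [simp]:
  "fst (transl n V v) i = fst v i + snd (snd v) * fst V i"
  "fst (snd (transl n V v)) = fst (snd v) + snd (snd v) * fst (snd V)
     - (form n v V + snd (snd v) * form n V V / 2)"
  "snd (snd (transl n V v)) = snd (snd v) + snd (snd v) * snd (snd V)"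
  by (simp_all add: transl_def)

lemma weight_eqI:
  "\<lbrakk>\<And>i. fst v i = fst w i; fst (snd v) = fst (snd w); snd (snd v) = snd (snd w)\<rbrakk> \<Longrightarrow> v = (w::weight)"
  by (simp add: prod_eq_iff fun_eq_iff)

lemma sum_weight_sel:
  fixes f :: "'a \<Rightarrow> weight"
  shows "fst (\<Sum>x\<in>A. f x) i = (\<Sum>x\<in>A. fst (f x) i)"
    and "fst (snd (\<Sum>x\<in>A. f x)) = (\<Sum>x\<in>A. fst (snd (f x)))"
    and "snd (snd (\<Sum>x\<in>A. f x)) = (\<Sum>x\<in>A. snd (snd (f x)))"
  by (induction A rule: infinite_finite_induct) auto

lemma form_commute: "form n v w = form n w v"
  by (simp add: form_def mult.commute add.commute)

lemma form_add_right: "form n u (v + w) = form n u v + form n u w"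
  by (simp add: form_def sum.distrib algebra_simps)

lemma form_diff_right: "form n u (v - w) = form n u v - form n u w"
  by (simp add: form_def sum_subtractf algebra_simps)

lemma form_scale_right: "form n u (t *\<^sub>W v) = t * form n u v"
  by (simp add: form_def sum_distrib_left algebra_simps)

lemma form_sum_right: "form n u (\<Sum>x\<in>A. f x) = (\<Sum>x\<in>A. form n u (f x))"
proof (induction A rule: infinite_finite_induct)
  case (insert x A)
  then show ?case by (simp add: form_add_right)
qed (simp_all add: form_def)

lemma form_add_left: "form n (v + w) u = form n v u + form n w u"
  by (simp add: form_commute[of n _ u] form_add_right)

lemma form_diff_left: "form n (v - w) u = form n v u - form n w u"
  by (simp add: form_commute[of n _ u] form_diff_right)

lemma form_scale_left: "form n (t *\<^sub>W v) u = t * form n v u"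
  by (simp add: form_commute[of n _ u] form_scale_right)

lemma form_delta_right [simp]: "form n v delta = snd (snd v)"
  by (simp add: form_def)

lemma form_omega_zero_right [simp]: "form n v omega_zero = fst (snd v)"
  by (simp add: form_def)


section \<open>Affine coordinate vectors\<close>

text \<open>
  The extension of \<open>\<epsilon>\<^sub>1, \<dots>, \<epsilon>\<^sub>n\<close> to all integer indices with \<open>\<epsilon>\<^bsub>l+n\<^esub> = \<epsilon>\<^sub>l - \<delta>\<close>. The index is lowered by
  one before division so that the representatives are \<open>1, \<dots>, n\<close> instead of \<open>0, \<dots>, n-1\<close>.
\<close>

definition eps_aff :: "nat \<Rightarrow> int \<Rightarrow> weight" where
  "eps_aff n l = eps ((l - 1) mod int n + 1) - of_int ((l - 1) div int n) *\<^sub>W delta"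

lemma alpha_eq_eps_aff:
  assumes "n \<ge> 2"
  shows "alpha n l = eps_aff n l - eps_aff n (l + 1)"
proof -
  define j q where "j = l mod int n" and "q = l div int n"
  have l: "l = q * int n + j" by (simp add: j_def q_def)
  have j: "0 \<le> j" "j < int n" using assms by (auto simp: j_def)
  show ?thesis
  proof (cases "j = 0")
    case True
    have e: "l - 1 = (int n - 1) + (q - 1) * int n" using l True by (simp add: algebra_simps)
    have "(l - 1) mod int n = int n - 1" "(l - 1) div int n = q - 1"
      unfolding e using assms
      by (simp_all only: mod_mult_self1 div_mult_self1) (simp_all add: zmod_minus1)
    then show ?thesis using True assms
      by (intro weight_eqI) (simp_all add: alpha_def eps_aff_def flip: j_def q_def)
  next
    case False
    have e: "l - 1 = (j - 1) + q * int n" using l by (simp add: algebra_simps)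
    have "(l - 1) mod int n = j - 1" "(l - 1) div int n = q"
      unfolding e using assms j False by (simp_all only: mod_mult_self1 div_mult_self1) simp_all
    then show ?thesis using False assms
      by (intro weight_eqI) (simp_all add: alpha_def eps_aff_def flip: j_def q_def)
  qed
qed

lemma alpha_seg_eq_eps_aff:
  assumes "n \<ge> 2" "l \<le> r"
  shows "alpha_seg n l r = eps_aff n l - eps_aff n r"
  using assms(2)
proof (induction r rule: int_ge_induct)
  case base
  then show ?case by (simp add: alpha_seg_def)
next
  case (step r)
  then have "{l..<r + 1} = insert r {l..<r}" by auto
  with step show ?case
    by (simp add: alpha_seg_def alpha_eq_eps_aff[OF assms(1)])
qed

lemma eps_aff_periodic:
  assumes "n > 0"
  shows "eps_aff n (l + int n * k) = eps_aff n l - of_int k *\<^sub>W delta"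
proof -
  have e: "l + int n * k - 1 = (l - 1) + k * int n" by simp
  have "(l + int n * k - 1) mod int n = (l - 1) mod int n"
    "(l + int n * k - 1) div int n = (l - 1) div int n + k"
    unfolding e using assms by simp_all
  then show ?thesis
    by (intro weight_eqI) (simp_all add: eps_aff_def)
qed

lemma form_eps_aff:
  assumes "n > 0"
  shows "form n (eps_aff n l) v
    = fst v ((l - 1) mod int n + 1) - of_int ((l - 1) div int n) * snd (snd v)"
proof -
  have "(l - 1) mod int n + 1 \<in> {1..int n}" using assms pos_mod_bound[of "int n" "l - 1"]
    by (simp del: pos_mod_bound)
  then show ?thesis
    by (simp add: form_def eps_aff_def if_distrib[of "\<lambda>x. x * _"] cong: if_cong)
qed


section \<open>Fundamental weights\<close>

text \<open>
  The functions differ by a constant, and equality of the sums makes \<open>n\<close> times this constant vanish.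
\<close>

lemma eq_of_differences:
  fixes f h :: "int \<Rightarrow> complex"
  assumes "n > 0"
    and "\<And>j. 1 \<le> j \<Longrightarrow> j < int n \<Longrightarrow> f j - f (j + 1) = h j - h (j + 1)"
    and "(\<Sum>j = 1..int n. f j) = (\<Sum>j = 1..int n. h j)"
    and "i \<in> {1..int n}"
  shows "f i = h i"
proof -
  have const: "f j - h j = f 1 - h 1" if "1 \<le> j" "j \<le> int n" for j
    using that
  proof (induction j rule: int_ge_induct)
    case (step j)
    have "f j - h j = f 1 - h 1" using step by simp
    moreover have "f j - f (j + 1) = h j - h (j + 1)" using step assms(2) by simp
    ultimately show ?case by (metis diff_eq_diff_eq diff_add_cancel diff_diff_eq2 add.commute)
  qed simp
  have "0 = (\<Sum>j = 1..int n. f j - h j)" using assms(3) by (simp add: sum_subtractf)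
  also have "\<dots> = (\<Sum>j = 1..int n. f 1 - h 1)" by (intro sum.cong) (auto intro: const)
  finally have "f 1 = h 1" using assms(1) by simp
  then show ?thesis using const[of i] assms(4) by simp
qed

lemma form_alpha:
  assumes "n \<ge> 2" "j < n"
  shows "form n w (alpha n (int j)) =
    (if j = 0 then snd (snd w) + fst w (int n) - fst w 1 else fst w (int j) - fst w (int j + 1))"
proof -
  have "(- 1) mod int n = int n - 1" "(- 1) div int n = - 1"
    using assms by (simp_all add: zmod_minus1 div_eq_minus1)
  moreover have "(int j - 1) mod int n = int j - 1" "(int j - 1) div int n = 0" if "j > 0"
    using assms that by simp_all
  ultimately show ?thesis using assms
    by (simp add: alpha_eq_eps_aff form_commute[of n w] form_diff_left form_eps_aff)
qed

lemma weight_eq_of_form_simple: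
  assumes n: "n \<ge> 2"
    and "v \<in> h_tilde n" "w \<in> h_tilde n"
    and al: "\<And>j. 1 \<le> j \<Longrightarrow> j < n \<Longrightarrow> form n v (alpha n (int j)) = form n w (alpha n (int j))"
    and "fst (snd v) = fst (snd w)" "snd (snd v) = snd (snd w)"
  shows "v = w"
proof -
  have d: "fst v j - fst v (j + 1) = fst w j - fst w (j + 1)" if "1 \<le> j" "j < int n" for j
    using al[of "nat j"] that n form_alpha[OF n, of "nat j"] by (simp add: nat_less_iff le_nat_iff)
  have "fst v i = fst w i" for i
  proof (cases "i \<in> {1..int n}")
    case True
    show ?thesis by (rule eq_of_differences[where f = "fst v" and h = "fst w", OF _ d _ True])
        (use assms in \<open>auto simp: h_tilde_def\<close>)
  next
    case False
    then show ?thesis using assms by (simp add: h_tilde_def)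
  qed
  with assms show ?thesis by (intro weight_eqI) simp_all
qed

text \<open>
  All \<open>n\<close> affine simple roots together with \<open>\<omega>\<^sub>0\<close> separate weights: the simple roots sum to
  \<open>\<delta>\<close>, which recovers the coefficient of \<open>\<omega>\<^sub>0\<close>. This is the uniqueness behind the definition of
  the fundamental weights.
\<close>

lemma weight_eq_of_form_alpha:
  assumes n: "n \<ge> 2"
    and "v \<in> h_tilde n" "w \<in> h_tilde n"
    and al: "\<And>j. j < n \<Longrightarrow> form n v (alpha n (int j)) = form n w (alpha n (int j))"
    and om: "form n v omega_zero = form n w omega_zero"
  shows "v = w"
proof -
  have delta: "delta = (\<Sum>j<n. alpha n (int j))"
  proof -
    have "(\<Sum>j<m. alpha n (int j)) = eps_aff n 0 - eps_aff n (int m)" for m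
      by (induction m) (simp_all add: alpha_eq_eps_aff[OF n] add.commute)
    then show ?thesis using eps_aff_periodic[of n 0 1] n
      by (simp add: scale_def prod_eq_iff fun_eq_iff)
  qed
  have "form n v delta = form n w delta"
    unfolding delta form_sum_right by (intro sum.cong) (auto simp: al)
  then show ?thesis using assms by (intro weight_eq_of_form_simple[OF n]) simp_all
qed

lemma sum_indicator_initial:
  assumes "i \<le> n"
  shows "(\<Sum>j = 1..int n. if j \<le> int i then (1::complex) else 0) = of_nat i"
proof -
  have "{1..int n} \<inter> {j. j \<le> int i} = {1..int i}" using assms by auto
  then show ?thesis by (simp add: sum.If_cases)
qed

lemma omega_eq:
  assumes n: "n \<ge> 2" and i: "i < n"
  shows "omega n i = (\<lambda>j. if j \<in> {1..int n} then (if j \<le> int i then 1 else 0) - of_nat i / of_nat n else 0, 0, 1)"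
    (is "_ = ?w")
proof -
  have w: "?w \<in> h_tilde n \<and> (\<forall>j<n. form n ?w (alpha n (int j)) = (if i = j then 1 else 0))
     \<and> form n ?w omega_zero = 0"
  proof (intro conjI allI impI)
    show "?w \<in> h_tilde n" using n i by (simp add: h_tilde_def sum_subtractf sum_indicator_initial)
    fix j assume "j < n"
    then show "form n ?w (alpha n (int j)) = (if i = j then 1 else 0)"
      using n i by (auto simp: form_alpha)
  qed simp
  show ?thesis unfolding omega_def
  proof (rule the_equality, rule w)
    fix v assume "v \<in> h_tilde n \<and> (\<forall>j<n. form n v (alpha n (int j)) = (if i = j then 1 else 0))
     \<and> form n v omega_zero = 0"
    with w show "v = ?w" by (intro weight_eq_of_form_alpha[OF n]) auto
  qed
qed

lemma form_alpha_omega: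
  assumes "n \<ge> 2" "i < n" "j < n"
  shows "form n (alpha n (int j)) (omega n i) = (if i = j then 1 else 0)"
  using assms by (auto simp: form_commute[of n "alpha _ _"] omega_eq form_alpha)

lemma omega_level: "n \<ge> 2 \<Longrightarrow> i < n \<Longrightarrow> snd (snd (omega n i)) = 1"
  by (simp add: omega_eq)

lemma omega_0: "n \<ge> 2 \<Longrightarrow> omega n 0 = omega_zero"
  by (rule weight_eqI) (auto simp: omega_eq)


section \<open>The extended affine Weyl group\<close>

lemma P_lattice_sel:
  assumes n: "n \<ge> 2" and V: "V \<in> P_lattice n"
  shows "V \<in> h_tilde n" "fst (snd V) = 0" "snd (snd V) = 0"
proof -
  interpret Z: module zscale by (rule module_zscale)
  have "Z.span {omega n i - omega n 0 | i. i \<in> {1..n - 1}}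
      \<subseteq> {V \<in> h_tilde n. fst (snd V) = 0 \<and> snd (snd V) = 0}" (is "_ \<subseteq> ?T")
  proof (rule Z.span_minimal)
    show "Z.subspace ?T"
      by (intro Z.subspaceI) (auto simp: h_tilde_def sum.distrib simp flip: sum_distrib_left)
    have om: "omega n i \<in> h_tilde n" if "i < n" for i
      using n that by (simp add: omega_eq h_tilde_def sum_subtractf sum_indicator_initial)
    have "omega n i - omega n 0 \<in> ?T" if "i < n" for i
      using om[of i] om[of 0] that n by (auto simp: h_tilde_def sum_subtractf omega_eq)
    moreover have "i < n" if "i \<in> {1..n - 1}" for i using that n by auto
    ultimately show "{omega n i - omega n 0 | i. i \<in> {1..n - 1}} \<subseteq> ?T" by blast
  qed
  then show "V \<in> h_tilde n" "fst (snd V) = 0" "snd (snd V) = 0"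
    using V by (auto simp: P_lattice_def)
qed

text \<open>
  Such a \<open>V\<close> equals \<open>\<Sum> m\<^sub>i (\<omega>\<^sub>i - \<omega>\<^sub>0)\<close>, since both sides have the same products with the finite
  simple roots.
\<close>

lemma P_latticeI:
  assumes n: "n \<ge> 2" and V: "V \<in> h_tilde n" "fst (snd V) = 0" "snd (snd V) = 0"
    and m: "\<And>i. 1 \<le> i \<Longrightarrow> i < n \<Longrightarrow> fst V (int i) - fst V (int i + 1) = of_int (m i)"
  shows "V \<in> P_lattice n"
proof -
  interpret Z: module zscale by (rule module_zscale)
  define U where "U = (\<Sum>i\<in>{1..n - 1}. zscale (m i) (omega n i - omega n 0))"
  have U: "U \<in> P_lattice n" unfolding U_def P_lattice_def
    by (intro Z.span_sum Z.span_scale Z.span_base) auto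
  have "V = U"
  proof (rule weight_eq_of_form_simple[OF n])
    fix j assume j: "1 \<le> j" "j < n"
    have "form n (alpha n (int j)) U = (\<Sum>i\<in>{1..n - 1}. of_int (m i) * (if i = j then 1 else 0))"
      unfolding U_def form_sum_right
      by (intro sum.cong)
        (use j n in \<open>auto simp: form_scale_right form_diff_right form_alpha_omega\<close>)
    also have "\<dots> = of_int (m j)" using j n
      by (auto simp: if_distrib[of "\<lambda>x. _ * x"] cong: if_cong)
    finally show "form n V (alpha n (int j)) = form n U (alpha n (int j))"
      using j n m[of j] by (simp add: form_commute[of n U] form_alpha)
  qed (use V P_lattice_sel[OF n U] in auto)
  with U show ?thesis by simp
qed

text \<open>
  For the translations, the coefficient of \<open>\<delta>\<close> in \<open>transl\<close> is chosen exactly to cancel the cross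
  terms that \<open>V\<close> produces in the finite part.
\<close>

lemma ext_aff_weyl_isometry:
  assumes n: "n \<ge> 2" and "\<gamma> \<in> ext_aff_weyl n"
  shows "form n (\<gamma> v) (\<gamma> w) = form n v w"
proof -
  obtain \<sigma> V where \<sigma>: "\<sigma> permutes {1..int n}" and V: "V \<in> P_lattice n"
    and \<gamma>: "\<gamma> = perm_act \<sigma> \<circ> transl n V"
    using assms by (auto simp: ext_aff_weyl_def)
  have perm: "form n (perm_act \<sigma> v) (perm_act \<sigma> w) = form n v w" for v w
    using sum.permute[OF permutes_inv[OF \<sigma>], of "\<lambda>i. fst v i * fst w i"]
    by (simp add: form_def o_def)
  have "form n (transl n V v) (transl n V w) = form n v w"
  proof -
    have V0: "form n u V = (\<Sum>i = 1..int n. fst u i * fst V i)" for u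
      using P_lattice_sel[OF n V] by (simp add: form_def)
    have "(\<Sum>i = 1..int n. fst (transl n V v) i * fst (transl n V w) i)
      = (\<Sum>i = 1..int n. fst v i * fst w i) + snd (snd w) * form n v V
        + snd (snd v) * form n w V + snd (snd v) * snd (snd w) * form n V V"
      unfolding V0 by (simp add: sum_distrib_left algebra_simps flip: sum.distrib)
    then show ?thesis using P_lattice_sel[OF n V]
      by (simp add: form_def[of n "transl n V v"] form_def[of n v w] algebra_simps)
  qed
  then show ?thesis by (simp add: \<gamma> perm)
qed

lemma perm_transl_root:
  assumes n: "n \<ge> 2" and \<sigma>: "\<sigma> permutes {1..int n}" and V: "V \<in> P_lattice n"
    and ij: "i \<in> {1..int n}" "j \<in> {1..int n}"
  shows "(perm_act \<sigma> \<circ> transl n V) (eps i - eps j + t *\<^sub>W delta)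
    = eps (\<sigma> i) - eps (\<sigma> j) + (t - (fst V i - fst V j)) *\<^sub>W delta"
proof -
  have "form n (eps i - eps j + t *\<^sub>W delta) V = fst V i - fst V j"
    using P_lattice_sel[OF n V] ij
    by (simp add: form_def sum_subtractf algebra_simps if_distrib[of "\<lambda>x. _ * x"] cong: if_cong)
  then show ?thesis
    by (intro weight_eqI) (auto simp: permutes_inv_eq[OF \<sigma>])
qed

lemma alpha_finite:
  assumes "1 \<le> i" "i < n"
  shows "alpha n (int i) = eps (int i) - eps (int i + 1)"
  using assms by (simp add: alpha_def Let_def)

text \<open>
  A real root remembers the ordered pair of its indices. This recovers the permutation of a Weyl group
  element from the images of simple roots.
\<close>

lemma real_root_eqD:
  assumes eq: "eps i - eps j + s *\<^sub>W delta = eps k - eps l + t *\<^sub>W delta" and "i \<noteq> j"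
  shows "i = k \<and> j = l \<and> s = t"
proof -
  have fin: "fst (eps i) m - fst (eps j) m = fst (eps k) m - fst (eps l) m" for m
    using arg_cong[OF eq, of "\<lambda>w. fst w m"] by (simp split del: if_split)
  have "s = t" using arg_cong[OF eq, of "\<lambda>w. fst (snd w)"] by simp
  then show ?thesis using fin[of i] fin[of j] \<open>i \<noteq> j\<close> by (auto split: if_splits)
qed

text \<open>
  The finite parts of the images of \<open>\<alpha>\<^sub>1, \<dots>, \<alpha>\<^bsub>n-1\<^esub>\<close> give the permutation at all of \<open>1, \<dots>, n\<close>,
  and their \<open>\<delta>\<close>-coefficients give the consecutive differences of the translation vector, whose
  coordinates sum to zero.
\<close>

lemma ext_aff_weyl_eqI:
  assumes n: "n \<ge> 2" and "\<gamma> \<in> ext_aff_weyl n" "\<gamma>' \<in> ext_aff_weyl n"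
    and eq: "\<And>i. 1 \<le> i \<Longrightarrow> i < n \<Longrightarrow> \<gamma> (alpha n (int i)) = \<gamma>' (alpha n (int i))"
  shows "\<gamma> = \<gamma>'"
proof -
  obtain \<sigma> V where \<sigma>: "\<sigma> permutes {1..int n}" and V: "V \<in> P_lattice n"
    and \<gamma>: "\<gamma> = perm_act \<sigma> \<circ> transl n V"
    using assms by (auto simp: ext_aff_weyl_def)
  obtain \<tau> U where \<tau>: "\<tau> permutes {1..int n}" and U: "U \<in> P_lattice n"
    and \<gamma>': "\<gamma>' = perm_act \<tau> \<circ> transl n U"
    using assms by (auto simp: ext_aff_weyl_def)
  have *: "\<sigma> (int i) = \<tau> (int i) \<and> \<sigma> (int i + 1) = \<tau> (int i + 1)
      \<and> fst V (int i) - fst V (int i + 1) = fst U (int i) - fst U (int i + 1)"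
    if i: "1 \<le> i" "i < n" for i
  proof -
    have al: "alpha n (int i) = eps (int i) - eps (int i + 1) + 0 *\<^sub>W delta"
      using i by (intro weight_eqI) (simp_all add: alpha_finite)
    have e: "eps (\<sigma> (int i)) - eps (\<sigma> (int i + 1)) + (0 - (fst V (int i) - fst V (int i + 1))) *\<^sub>W delta
        = eps (\<tau> (int i)) - eps (\<tau> (int i + 1)) + (0 - (fst U (int i) - fst U (int i + 1))) *\<^sub>W delta"
      using eq[OF i] i perm_transl_root[OF n \<sigma> V, of "int i" "int i + 1" 0]
        perm_transl_root[OF n \<tau> U, of "int i" "int i + 1" 0]
      unfolding \<gamma> \<gamma>' al by simp
    have "\<sigma> (int i) \<noteq> \<sigma> (int i + 1)"
      by (simp add: inj_eq[OF permutes_inj[OF \<sigma>]])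
    from real_root_eqD[OF e this] show ?thesis by (simp only: diff_0 neg_equal_iff_equal)
  qed
  have differences: "fst V (int i) - fst V (int i + 1) = fst U (int i) - fst U (int i + 1)"
    if "1 \<le> i" "i < n" for i using *[OF that] by blast
  have "\<sigma> k = \<tau> k" for k
  proof (cases "k \<in> {1..int n}")
    case True
    show ?thesis
    proof (cases "k = 1")
      case True
      then show ?thesis using conjunct1[OF *[of 1]] n by simp
    next
      case False
      with True have k: "1 \<le> nat (k - 1)" "nat (k - 1) < n" "int (nat (k - 1)) + 1 = k"
        by (auto simp: nat_less_iff le_nat_iff)
      show ?thesis using conjunct1[OF conjunct2[OF *[OF k(1,2)]]] unfolding k(3) .
    qed
  next
    case False
    then show ?thesis using \<sigma> \<tau> by (simp add: permutes_not_in)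
  qed
  then have "\<sigma> = \<tau>" by (rule ext)
  moreover have "V = U"
    using P_lattice_sel[OF n V] P_lattice_sel[OF n U] differences n
    by (intro weight_eq_of_form_simple[OF n]) (simp_all add: form_alpha)
  ultimately show ?thesis using \<gamma> \<gamma>' by simp
qed

text \<open>
  Any \<open>h\<^sub>1, \<dots>, h\<^sub>n\<close> that are distinct modulo \<open>n\<close> arise as images of the indices: the permutation
  takes the residues of the \<open>h\<^sub>i\<close>, and the translation absorbs the multiples of \<open>\<delta>\<close>.
\<close>

lemma ext_aff_weyl_exists:
  assumes n: "n \<ge> 2" and inj: "inj_on (\<lambda>i. h i mod int n) {1..int n}"
  obtains \<gamma> where "\<gamma> \<in> ext_aff_weyl n"
    and "\<And>i j t. i \<in> {1..int n} \<Longrightarrow> j \<in> {1..int n} \<Longrightarrow>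
      \<gamma> (eps i - eps j + t *\<^sub>W delta) = eps_aff n (h i) - eps_aff n (h j) + t *\<^sub>W delta"
proof -
  define q where "q i = (h i - 1) div int n" for i
  define \<sigma> where "\<sigma> i = (if i \<in> {1..int n} then (h i - 1) mod int n + 1 else i)" for i
  (* Only differences of coordinates of V act on roots; subtracting the mean makes them sum to 0. *)
  define mean where "mean = (\<Sum>i = 1..int n. of_int (q i)) / (of_nat n :: complex)"
  define V :: weight where "V = (\<lambda>i. if i \<in> {1..int n} then of_int (q i) - mean else 0, 0, 0)"
  have \<sigma>: "\<sigma> permutes {1..int n}"
  proof (rule bij_imp_permutes)
    have sub: "\<sigma> ` {1..int n} \<subseteq> {1..int n}"
      using n by (auto simp: \<sigma>_def add1_zle_eq simp del: zle_add1_eq_le)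
    have "inj_on \<sigma> {1..int n}"
    proof (rule inj_onI)
      fix i j assume ij: "i \<in> {1..int n}" "j \<in> {1..int n}" and "\<sigma> i = \<sigma> j"
      then have "(h i - 1 + 1) mod int n = (h j - 1 + 1) mod int n"
        by (intro mod_add_cong) (auto simp: \<sigma>_def)
      then show "i = j" using inj ij by (simp add: inj_on_def)
    qed
    with sub show "bij_betw \<sigma> {1..int n} {1..int n}"
      by (simp add: bij_betw_def endo_inj_surj)
  qed (auto simp: \<sigma>_def)
  have V: "V \<in> P_lattice n"
  proof (rule P_latticeI[OF n])
    show "V \<in> h_tilde n" using n by (simp add: h_tilde_def V_def sum_subtractf mean_def)
    show "fst V (int i) - fst V (int i + 1) = of_int (q (int i) - q (int i + 1))"
      if "1 \<le> i" "i < n" for i using that by (simp add: V_def)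
  qed (simp_all add: V_def)
  show ?thesis
  proof
    show "perm_act \<sigma> \<circ> transl n V \<in> ext_aff_weyl n"
      unfolding ext_aff_weyl_def using \<sigma> V by blast
    fix i j t assume ij: "i \<in> {1..int n}" "j \<in> {1..int n}"
    show "(perm_act \<sigma> \<circ> transl n V) (eps i - eps j + t *\<^sub>W delta)
        = eps_aff n (h i) - eps_aff n (h j) + t *\<^sub>W delta"
      unfolding perm_transl_root[OF n \<sigma> V ij] using ij
      by (intro weight_eqI) (simp_all add: eps_aff_def \<sigma>_def V_def q_def)
  qed
qed


section \<open>The sequence of the parametrization\<close>

lemma int_step_const:
  fixes f :: "int \<Rightarrow> 'a"
  assumes "\<And>s. f (s + 1) = f s"
  shows "f s = f 0"
proof (induction s rule: int_induct[where k = 0])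
  case (step1 i)
  then show ?case using assms[of i] by simp
next
  case (step2 i)
  then show ?case using assms[of "i - 1"] by simp
qed simp

lemma gseq_mono: "s < t \<Longrightarrow> gseq n b s < gseq n b t"
proof (induction t rule: int_gr_induct)
  case base
  show ?case using gseq_step[of n b s] by simp
next
  case (step t)
  then show ?case using gseq_step[of n b t] by simp
qed

text \<open>
  One period of the sequence adds \<open>\<Sum>(b\<^sub>i + 1) = p'n\<close>.
\<close>

lemma gseq_shift:
  assumes "p' > 0" and b: "(\<Sum>i<n. b i) = p' * n - n"
  shows "gseq n b (s + int n * k) = gseq n b s + k * int (p' * n)"
proof -
  have init: "gseq n b (int m) = (\<Sum>i<m. int (b i) + 1)" if "m \<le> n" for m
    using that
  proof (induction m)
    case (Suc m)
    then show ?case using gseq_step[of n b "int m"] by (simp add: add.commute)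
  qed (simp add: gseq_0)
  have "n \<le> p' * n" using assms(1) by simp
  then have gn: "gseq n b (int n) = int (p' * n)"
    using b by (simp add: init sum.distrib flip: of_nat_sum)
  have period: "gseq n b (s + int n) - gseq n b s = int (p' * n)" for s
  proof -
    have "gseq n b (s + 1 + int n) - gseq n b (s + 1) = gseq n b (s + int n) - gseq n b s" for s
      using gseq_step[of n b s] gseq_step[of n b "s + int n"] by (simp add: algebra_simps)
    from int_step_const[of "\<lambda>s. gseq n b (s + int n) - gseq n b s", OF this, of s]
    show ?thesis by (simp add: gn gseq_0)
  qed
  have "gseq n b (s + int n * (k + 1)) - (k + 1) * int (p' * n)
      = gseq n b (s + int n * k) - k * int (p' * n)" for k
    using period[of "s + int n * k"] by (simp add: algebra_simps)
  from int_step_const[of "\<lambda>k. gseq n b (s + int n * k) - k * int (p' * n)", OF this, of k]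
  show ?thesis by simp
qed

lemma gseq_mod_surj:
  assumes n: "n > 0" and inj: "inj_on (\<lambda>s. gseq n b (int s) mod int n) {..<n}"
  obtains s u where "s < n" "l = gseq n b (int s) + int n * u"
proof -
  have "(\<lambda>s. gseq n b (int s) mod int n) ` {..<n} = {0..<int n}"
    by (rule card_subset_eq) (use n in \<open>auto simp: card_image[OF inj]\<close>)
  moreover have "l mod int n \<in> {0..<int n}" using n by simp
  ultimately obtain s where s: "s < n" "gseq n b (int s) mod int n = l mod int n"
    by (metis (no_types, lifting) imageE lessThan_iff)
  then obtain u where "l = gseq n b (int s) + int n * u"
    by (metis mod_eqE)
  with s show ?thesis using that by blast
qed

text \<open>
  The image of \<open>\<alpha>'\<^sub>0 = \<epsilon>\<^sub>n - \<epsilon>\<^sub>1 + p'\<delta>\<close> comes out right because \<open>g\<^sub>n = g\<^sub>0 + p'n\<close>: the vector at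
  \<open>g\<^sub>n\<close> is the one at \<open>g\<^sub>0\<close> minus \<open>p'\<delta>\<close>.
\<close>

lemma gamma_g_spec:
  assumes n: "n \<ge> 2" and "p' > 0" and pp: "param_pair n p p' a b"
  shows "gamma_g n p' b \<in> ext_aff_weyl n"
    and "s < n \<Longrightarrow> gamma_g n p' b (alpha_prime n p' s)
      = alpha_seg n (gseq n b (int s)) (gseq n b (int s + 1))"
proof -
  let ?g = "gseq n b"
  have shift: "?g (s + int n * k) = ?g s + k * int (p' * n)" for s k
    using pp by (intro gseq_shift assms) (simp add: param_pair_def)
  have inj0: "inj_on (\<lambda>s. ?g (int s) mod int n) {..<n}" using pp by (simp add: param_pair_def)
  have "inj_on (\<lambda>i. ?g i mod int n) {1..int n}"
  proof (rule inj_onI)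
    have mod: "?g i mod int n = ?g (i mod int n) mod int n" for i
      using shift[of "i mod int n" "i div int n"] by (simp flip: mult.assoc)
    fix i j assume ij: "i \<in> {1..int n}" "j \<in> {1..int n}" and "?g i mod int n = ?g j mod int n"
    then have "?g (i mod int n) mod int n = ?g (j mod int n) mod int n" using mod by metis
    then have "nat (i mod int n) = nat (j mod int n)"
      using n by (intro inj_onD[OF inj0]) (auto simp: nat_less_iff)
    then have "i mod int n = j mod int n" using n by (subst (asm) eq_nat_nat_iff) auto
    then have "(i - 1) mod int n = (j - 1) mod int n" by (rule mod_diff_cong) simp
    then show "i = j" using ij by simp
  qed
  then obtain \<gamma> where \<gamma>: "\<gamma> \<in> ext_aff_weyl n"
    and root: "\<And>i j t. i \<in> {1..int n} \<Longrightarrow> j \<in> {1..int n} \<Longrightarrow>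
      \<gamma> (eps i - eps j + t *\<^sub>W delta) = eps_aff n (?g i) - eps_aff n (?g j) + t *\<^sub>W delta"
    using ext_aff_weyl_exists[OF n] by metis
  have "\<gamma> (alpha_prime n p' s) = alpha_seg n (?g (int s)) (?g (int s + 1))" if s: "s < n" for s
  proof -
    have seg: "alpha_seg n (?g (int s)) (?g (int s + 1)) = eps_aff n (?g (int s)) - eps_aff n (?g (int s + 1))"
      using gseq_mono[of "int s" "int s + 1" n b] by (intro alpha_seg_eq_eps_aff n) simp
    show ?thesis
    proof (cases "s = 0")
      case True
      have "alpha_prime n p' s = eps (int n) - eps 1 + of_nat p' *\<^sub>W delta"
        by (intro weight_eqI) (simp_all add: True alpha_prime_def alpha_def)
      then have "\<gamma> (alpha_prime n p' s)
          = eps_aff n (?g (int n)) - eps_aff n (?g 1) + of_nat p' *\<^sub>W delta"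
        using root[of "int n" 1 "of_nat p'"] n by simp
      moreover have "?g (int n) = ?g 0 + int n * int p'"
        using shift[of 0 1] by (simp add: mult.commute)
      then have "eps_aff n (?g (int n)) = eps_aff n (?g 0) - of_nat p' *\<^sub>W delta"
        using eps_aff_periodic[of n "?g 0" "int p'"] n by simp
      ultimately show ?thesis using seg True by simp
    next
      case False
      have "alpha_prime n p' s = eps (int s) - eps (int s + 1) + 0 *\<^sub>W delta"
        using False s by (intro weight_eqI) (simp_all add: alpha_prime_def alpha_finite)
      then show ?thesis using root[of "int s" "int s + 1" 0] False s seg
        by (simp add: scale_def zero_prod_def[symmetric] zero_fun_def[symmetric])
    qed
  qed
  note * = this
  have "\<exists>!\<gamma>. \<gamma> \<in> ext_aff_weyl n \<and>
      (\<forall>s<n. \<gamma> (alpha_prime n p' s) = alpha_seg n (?g (int s)) (?g (int s + 1)))"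
  proof (rule ex1I[of _ \<gamma>], use \<gamma> * in blast)
    fix \<gamma>' assume "\<gamma>' \<in> ext_aff_weyl n \<and>
      (\<forall>s<n. \<gamma>' (alpha_prime n p' s) = alpha_seg n (?g (int s)) (?g (int s + 1)))"
    moreover have "alpha_prime n p' i = alpha n (int i)" if "1 \<le> i" for i
      using that by (simp add: alpha_prime_def)
    ultimately show "\<gamma>' = \<gamma>"
      using \<gamma> * by (intro ext_aff_weyl_eqI[OF n]) metis+
  qed
  from theI'[OF this] show "gamma_g n p' b \<in> ext_aff_weyl n"
    and "s < n \<Longrightarrow> gamma_g n p' b (alpha_prime n p' s)
      = alpha_seg n (?g (int s)) (?g (int s + 1))"
    by (auto simp: gamma_g_def)
qed
section \<open>Differences of the numbers y along the sequence\<close>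

text \<open>
  The product is computed before \<open>\<gamma>\<close> is applied; the correction \<open>c \<delta>\<close> is orthogonal to roots. For
  \<open>s = 0\<close> the term \<open>(p'-1)\<delta>\<close> in \<open>\<alpha>'\<^sub>0\<close> contributes \<open>(p'-1)\<kappa>\<close>, as the level of the weight is
  \<open>p - (p'-1)\<kappa> = \<kappa>\<close>; this cancels the contribution of \<open>-(p'-1)\<kappa>\<omega>\<^sub>0\<close>.
\<close>

lemma y_diff_gseq:
  assumes n: "n \<ge> 2" and "p' > 0" "p \<ge> n" and pp: "param_pair n p p' a b"
    and \<Lambda>: "\<Lambda> = Lambda_ab n p p' a b" and s: "s < n"
  shows "y_diff n \<Lambda> (gseq n b (int s)) (gseq n b (int s + 1)) = of_nat (a s) + 1"
proof -
  let ?\<gamma> = "gamma_g n p' b" and ?\<alpha> = "alpha_prime n p' s"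
  define k :: complex where "k = (of_nat p' - 1) * (of_nat p / of_nat p')"
  define v where "v = (\<Sum>i<n. of_nat (a i) *\<^sub>W omega n i) - k *\<^sub>W omega_zero + rho n"
  obtain c where "\<Lambda> = ?\<gamma> v - rho n - c *\<^sub>W delta"
    using \<Lambda> by (auto simp: Lambda_ab_def Let_def v_def k_def)
  then have \<Lambda>\<rho>: "\<Lambda> + rho n = ?\<gamma> v - c *\<^sub>W delta" by simp
  have seg: "?\<gamma> ?\<alpha> = alpha_seg n (gseq n b (int s)) (gseq n b (int s + 1))"
    using gamma_g_spec[OF n \<open>p' > 0\<close> pp] s by simp
  have "snd (snd (alpha_seg n l r)) = 0" for l r
    by (simp add: alpha_seg_def sum_weight_sel alpha_eq_eps_aff[OF n] eps_aff_def)
  then have "y_diff n \<Lambda> (gseq n b (int s)) (gseq n b (int s + 1)) = form n (?\<gamma> ?\<alpha>) (?\<gamma> v)"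
    by (simp add: y_diff_def \<Lambda>\<rho> form_diff_right form_scale_right seg)
  also have "\<dots> = form n ?\<alpha> v"
    using gamma_g_spec[OF n \<open>p' > 0\<close> pp] by (intro ext_aff_weyl_isometry[OF n]) simp
  also have "\<dots> = of_nat (a s) + 1"
  proof -
    have simple: "form n (alpha n (int s)) v = of_nat (a s) - (if s = 0 then k else 0) + 1"
    proof -
      have "form n (alpha n (int s)) omega_zero = (if s = 0 then 1 else 0)"
        using form_alpha_omega[OF n _ s, of 0] n by (simp add: omega_0)
      moreover have "(\<Sum>i<n. of_nat (a i) * form n (alpha n (int s)) (omega n i)) = of_nat (a s)"
        using s by (simp add: form_alpha_omega[OF n _ s] if_distrib[of "\<lambda>x. _ * x"] cong: if_cong)
      moreover have "(\<Sum>i<n. form n (alpha n (int s)) (omega n i)) = 1"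
        using s by (simp add: form_alpha_omega[OF n _ s])
      ultimately show ?thesis
        by (simp add: v_def rho_def form_add_right form_diff_right form_scale_right form_sum_right
            del: form_omega_zero_right)
    qed
    have "(\<Sum>i<n. of_nat (a i) :: complex) = of_nat (p - n)"
      using pp by (simp add: param_pair_def flip: of_nat_sum)
    then have level: "form n delta v = of_nat p - k"
      using n \<open>p \<ge> n\<close>
      by (simp add: form_commute[of n delta] v_def rho_def sum_weight_sel omega_level of_nat_diff)
    show ?thesis
    proof (cases "s = 0")
      case True
      have "(of_nat p' - 1) * (of_nat p - k) = k"
        using \<open>p' > 0\<close> by (simp add: k_def field_simps)
      then show ?thesis using True simple level
        by (simp add: alpha_prime_def form_add_left form_scale_left)
    next
      case False
      then show ?thesis using simple by (simp add: alpha_prime_def)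
    qed
  qed
  finally show ?thesis .
qed

definition y_coord :: "nat \<Rightarrow> weight \<Rightarrow> int \<Rightarrow> complex" where
  "y_coord n \<Lambda> l = form n (eps_aff n l) (\<Lambda> + rho n)"

lemma y_diff_eq_y_coord:
  assumes "n \<ge> 2" "l \<le> r"
  shows "y_diff n \<Lambda> l r = y_coord n \<Lambda> l - y_coord n \<Lambda> r"
  using assms by (simp add: y_diff_def y_coord_def alpha_seg_eq_eps_aff form_diff_left)

lemma y_coord_shift:
  assumes n: "n \<ge> 2"
  shows "y_coord n \<Lambda> (l + int n * k) = y_coord n \<Lambda> l - of_int k * kappa n \<Lambda>"
proof -
  have "form n delta (\<Lambda> + rho n) = kappa n \<Lambda>"
    using n by (simp add: form_commute[of n delta] kappa_def rho_def sum_weight_sel omega_level)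
  then show ?thesis using n
    by (simp add: y_coord_def eps_aff_periodic form_diff_left form_scale_left)
qed

lemma y_coord_gseq_diff:
  assumes n: "n \<ge> 2" and "p' > 0" "p \<ge> n" and pp: "param_pair n p p' a b"
    and \<Lambda>: "\<Lambda> = Lambda_ab n p p' a b" and "s \<le> t"
  shows "y_coord n \<Lambda> (gseq n b s) - y_coord n \<Lambda> (gseq n b t)
    = of_int (\<Sum>q = s..<t. int (a (nat (q mod int n))) + 1)"
proof -
  let ?Y = "\<lambda>s. y_coord n \<Lambda> (gseq n b s)"
  have step: "?Y q - ?Y (q + 1) = of_nat (a (nat (q mod int n))) + 1" for q
  proof -
    define r u where "r = q mod int n" and "u = q div int n"
    have q: "q = r + int n * u" by (simp add: r_def u_def)
    have r: "0 \<le> r" "nat r < n" using n by (auto simp: r_def nat_less_iff)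
    have shift: "gseq n b (x + int n * u) = gseq n b x + int n * (int p' * u)" for x
      using gseq_shift[of p' b n x u] pp \<open>p' > 0\<close> by (simp add: param_pair_def mult_ac)
    have "?Y q - ?Y (q + 1) = ?Y r - ?Y (r + 1)"
      using shift[of r] shift[of "r + 1"] by (simp add: q y_coord_shift[OF n] add_ac)
    also have "\<dots> = y_diff n \<Lambda> (gseq n b r) (gseq n b (r + 1))"
      using gseq_mono[of r "r + 1" n b] by (simp add: y_diff_eq_y_coord[OF n])
    also have "\<dots> = of_nat (a (nat r)) + 1"
      using y_diff_gseq[OF assms(1-5) r(2)] r(1) by simp
    finally show ?thesis by (simp add: r_def)
  qed
  show ?thesis using \<open>s \<le> t\<close>
  proof (induction t rule: int_ge_induct)
    case (step t)
    then have "{s..<t + 1} = insert t {s..<t}" by auto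
    then show ?case using step.IH \<open>?Y t - ?Y (t + 1) = _\<close>
      by (simp add: algebra_simps)
  qed simp
qed

text \<open>
  Write \<open>l = g\<^sub>s + nu\<close> and \<open>r = g\<^sub>t + nv\<close>. Since \<open>y\<close> has integer differences along \<open>g\<close>, the number
  \<open>(v - u) p/p'\<close> is an integer, so \<open>p'\<close> divides \<open>v - u\<close>. The surplus \<open>n(v - u)\<close> is then a
  multiple of \<open>p'n\<close> and can be absorbed into the index \<open>t\<close>.
\<close>

lemma integral_pair_gseq:
  assumes n: "n \<ge> 2" and "p' > 0" "p \<ge> n" "coprime p p'" and pp: "param_pair n p p' a b"
    and \<Lambda>: "\<Lambda> = Lambda_ab n p p' a b" and \<kappa>: "kappa n \<Lambda> = of_nat p / of_nat p'"
    and "l < r" and int: "y_diff n \<Lambda> l r \<in> \<int>"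
  obtains s t u where "s < t" "l = gseq n b s + int n * u" "r = gseq n b t + int n * u"
proof -
  let ?g = "gseq n b" and ?Y = "y_coord n \<Lambda>"
  have inj: "inj_on (\<lambda>s. ?g (int s) mod int n) {..<n}" using pp by (simp add: param_pair_def)
  obtain s u where l: "l = ?g (int s) + int n * u"
    using gseq_mod_surj[OF _ inj] n by (metis gr0I not_numeral_le_zero)
  obtain t v where r: "r = ?g (int t) + int n * v"
    using gseq_mod_surj[OF _ inj] n by (metis gr0I not_numeral_le_zero)
  have le: "?Y (?g x) - ?Y (?g y) \<in> \<int>" if "x \<le> y" for x y
    unfolding y_coord_gseq_diff[OF n assms(2,3) pp \<Lambda> that] by (rule Ints_of_int)
  have "?Y (?g x) - ?Y (?g y) \<in> \<int>" for x y
    using le[of x y] le[of y x, THEN Ints_minus] by (cases "x \<le> y") auto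
  note this[of "int s" "int t"]
  moreover have "?Y l - ?Y r \<in> \<int>" using int \<open>l < r\<close> by (simp add: y_diff_eq_y_coord[OF n])
  ultimately have "(?Y l - ?Y r) - (?Y (?g (int s)) - ?Y (?g (int t))) \<in> \<int>" by (rule Ints_diff[rotated])
  also have "(?Y l - ?Y r) - (?Y (?g (int s)) - ?Y (?g (int t))) = of_int (v - u) * (of_nat p / of_nat p')"
    unfolding l r y_coord_shift[OF n] \<kappa> by (simp add: algebra_simps diff_divide_distrib)
  finally obtain m where "of_int (v - u) * (of_nat p / of_nat p') = (of_int m :: complex)"
    by (auto elim: Ints_cases)
  then have "of_int ((v - u) * int p) = (of_int (m * int p') :: complex)"
    using \<open>p' > 0\<close> by (simp add: field_simps)
  then have "(v - u) * int p = m * int p'" by (simp only: of_int_eq_iff)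
  then have "int p' dvd (v - u) * int p" by simp
  then have "int p' dvd v - u"
    using \<open>coprime p p'\<close> by (simp add: coprime_dvd_mult_left_iff coprime_commute)
  then obtain w where w: "v = u + int p' * w" by (metis dvdE diff_eq_eq add.commute)
  have r': "r = ?g (int t + int n * w) + int n * u"
    using gseq_shift[of p' b n "int t" w] pp \<open>p' > 0\<close>
    by (simp add: r w param_pair_def algebra_simps)
  have "int s < int t + int n * w"
    using \<open>l < r\<close> gseq_mono[of "int t + int n * w" "int s" n b] unfolding l r'
    by (cases "int s" "int t + int n * w" rule: linorder_cases) auto
  with l r' that show ?thesis by blast
qed


section \<open>Chains of inequalities in a pattern\<close>

lemma pattern_shift:
  assumes "affine_GT_pattern n d" "j \<le> i"
  shows "d (i + int n * k) (j + int n * k) = d i j"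
proof -
  have period: "d (i + int n) (j + int n) = d i j" if "j \<le> i" for i j
    using assms(1) that by (simp add: affine_GT_pattern_def)
  have "d (i + int n * (k + 1)) (j + int n * (k + 1)) = d (i + int n * k) (j + int n * k)" for k
    using period[of "j + int n * k" "i + int n * k"] assms(2) by (simp add: algebra_simps)
  from int_step_const[of "\<lambda>k. d (i + int n * k) (j + int n * k)", OF this, of k]
  show ?thesis by simp
qed

text \<open>
  Each adjacent step raises the first index by one; going back from \<open>i + 1\<close> to \<open>i\<close> can only
  increase the entry, so the steps can be composed.
\<close>

lemma pattern_chain:
  fixes g :: "int \<Rightarrow> int" and a :: "int \<Rightarrow> nat"
  assumes d: "affine_GT_pattern n d"
    and mono: "\<And>s t. s < t \<Longrightarrow> g s < g t"
    and step: "\<And>s i. i \<ge> g (s + 1) - 1 \<Longrightarrow> d i (g s) \<le> d (i + 1) (g (s + 1)) + a s"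
    and "s < t" "i \<ge> g t - 1"
  shows "d i (g s) \<le> d (i + 1) (g t) + (\<Sum>q = s..<t. a q)"
  using \<open>s < t\<close> \<open>i \<ge> g t - 1\<close>
proof (induction t rule: int_gr_induct)
  case base
  have "{s..<s + 1} = {s}" by auto
  with base show ?case using step[of s i] by simp
next
  case (step t)
  have lt: "g t \<le> i" using step.prems mono[of t "t + 1"] by simp
  then have "d i (g s) \<le> d (i + 1) (g t) + (\<Sum>q = s..<t. a q)" by (intro step.IH) simp
  also have "d (i + 1) (g t) \<le> d i (g t)" using d lt by (simp add: affine_GT_pattern_def)
  also have "d i (g t) \<le> d (i + 1) (g (t + 1)) + a t" using step.prems by (intro assms(3))
  also have "{s..<t + 1} = insert t {s..<t}" using step.hyps by auto
  then have "d (i + 1) (g (t + 1)) + a t + (\<Sum>q = s..<t. a q)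
      = d (i + 1) (g (t + 1)) + (\<Sum>q = s..<t + 1. a q)" by simp
  finally show ?case by simp
qed


section \<open>Reduction of the permitted condition to adjacent pairs\<close>

theorem proposition4p9:
  fixes n p p' :: nat
    and \<Lambda> :: weight
    and a b :: "nat \<Rightarrow> nat"
    and d :: "int \<Rightarrow> int \<Rightarrow> nat"
  assumes "n \<ge> 3"
    and "admissible n \<Lambda>"
    and "\<Lambda> \<noteq> 0"
    and "p > 0" and "p' > 0" and "coprime p p'" and "p \<ge> n"
    and "kappa n \<Lambda> = of_nat p / of_nat p'"
    and "param_pair n p p' a b"
    and "\<Lambda> = Lambda_ab n p p' a b"
    and "affine_GT_pattern n d"
  shows "permitted n \<Lambda> d \<longleftrightarrow>
    (\<forall>s<n. \<forall>i \<ge> gseq n b (int s + 1) - 1.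
       d i (gseq n b (int s)) \<le> d (i + 1) (gseq n b (int s + 1)) + a s)"
    (is "_ \<longleftrightarrow> ?adjacent")
proof
  let ?g = "gseq n b"
  have n: "n \<ge> 2" using assms(1) by simp
  have shift: "?g (x + int n * u) = ?g x + int n * (int p' * u)" for x u
    using gseq_shift[of p' b n x u] assms by (simp add: param_pair_def mult_ac)
  have inj: "inj_on (\<lambda>s. ?g (int s) mod int n) {..<n}"
    using assms by (simp add: param_pair_def)
  {
    assume perm: "permitted n \<Lambda> d"
    show ?adjacent
    proof (intro allI impI)
      fix s i assume s: "s < n" and i: "?g (int s + 1) - 1 \<le> i"
      have "?g (int s) mod int n \<noteq> ?g (int s + 1) mod int n"
      proof (cases "s + 1 < n")
        case True
        then show ?thesis using inj_onD[OF inj, of s "s + 1"] by (auto simp: add.commute)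
      next
        case False
        (* Here s + 1 = n, whose term is congruent to that of 0; and 0 differs from s as n > 1. *)
        then have "?g (int s + 1) = ?g (0 + int n * 1)" using s by (intro arg_cong[of _ _ ?g]) simp
        then have "?g (int s + 1) mod int n = ?g (int 0) mod int n" unfolding shift by simp
        then show ?thesis using inj_onD[OF inj, of s 0] s n False by auto
      qed
      moreover have "y_diff n \<Lambda> (?g (int s)) (?g (int s + 1)) = of_int (int (a s) + 1)"
        using y_diff_gseq[OF n _ _ _ _ s] assms by simp
      ultimately have "int (d i (?g (int s))) \<le> int (d (i + 1) (?g (int s + 1))) + (int (a s) + 1) - 1"
        using perm i gseq_mono[of "int s" "int s + 1" n b] unfolding permitted_def by (metis less_add_one)
      then show "d i (?g (int s)) \<le> d (i + 1) (?g (int s + 1)) + a s" by simp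
    qed
  }
  {
    assume adj: ?adjacent
    let ?a = "\<lambda>q. a (nat (q mod int n))"
    have step: "d i (?g s) \<le> d (i + 1) (?g (s + 1)) + ?a s" if i: "i \<ge> ?g (s + 1) - 1" for s i
    proof -
      define r u where "r = s mod int n" and "u = s div int n"
      have s: "s = r + int n * u" by (simp add: r_def u_def)
      have r: "0 \<le> r" "nat r < n" using n by (auto simp: r_def nat_less_iff)
      define j where "j = i - int n * (int p' * u)"
      have gs: "?g s = ?g r + int n * (int p' * u)" "?g (s + 1) = ?g (r + 1) + int n * (int p' * u)"
        using shift[of r u] shift[of "r + 1" u] by (simp_all add: s add_ac)
      have j: "?g (r + 1) - 1 \<le> j" using i gs by (simp add: j_def)
      have "d i (?g s) = d j (?g r)"
        using pattern_shift[OF assms(11), of "?g r" j "int p' * u"] j gseq_mono[of r "r + 1" n b]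
        by (simp add: gs j_def)
      moreover have "d (i + 1) (?g (s + 1)) = d (j + 1) (?g (r + 1))"
        using pattern_shift[OF assms(11), of "?g (r + 1)" "j + 1" "int p' * u"] j
        unfolding gs(2) by (simp add: j_def algebra_simps)
      ultimately show ?thesis using adj[rule_format, of "nat r" j] r j by (simp add: r_def)
    qed
    show "permitted n \<Lambda> d" unfolding permitted_def
    proof (intro allI impI)
      fix l r m i assume lr: "l < r" and m: "y_diff n \<Lambda> l r = of_int m" and i: "r - 1 \<le> i"
      obtain s t u where st: "s < t" and l: "l = ?g s + int n * u" and r: "r = ?g t + int n * u"
        using integral_pair_gseq[OF n assms(5,7,6,9,10,8) lr] m by (metis Ints_of_int)
      define j where "j = i - int n * u"
      have j: "?g t - 1 \<le> j" using i r by (simp add: j_def)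
      have "of_int m = y_coord n \<Lambda> (?g s) - y_coord n \<Lambda> (?g t)"
        using m lr by (simp add: y_diff_eq_y_coord[OF n] l r y_coord_shift[OF n])
      also have "\<dots> = of_int (\<Sum>q = s..<t. int (?a q) + 1)"
        using st by (intro y_coord_gseq_diff[OF n assms(5,7,9,10)]) simp
      finally have "m = (\<Sum>q = s..<t. int (?a q) + 1)" by (simp only: of_int_eq_iff)
      also have "\<dots> = int (\<Sum>q = s..<t. ?a q) + (t - s)" using st by (simp add: sum.distrib)
      finally have m': "int (\<Sum>q = s..<t. ?a q) \<le> m - 1" using st by simp
      have "d j (?g s) \<le> d (j + 1) (?g t) + (\<Sum>q = s..<t. ?a q)"
        by (rule pattern_chain[OF assms(11) gseq_mono step st j])
      then have "int (d j (?g s)) \<le> int (d (j + 1) (?g t)) + m - 1" using m' by linarith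
      moreover have "d i l = d j (?g s)"
        using pattern_shift[OF assms(11), of "?g s" j u] j gseq_mono[OF st, of n b]
        by (simp add: l j_def)
      moreover have "d (i + 1) r = d (j + 1) (?g t)"
        using pattern_shift[OF assms(11), of "?g t" "j + 1" u] j
        by (simp add: r j_def algebra_simps)
      ultimately show "int (d i l) \<le> int (d (i + 1) r) + m - 1" by simp
    qed
  }
qed

end
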